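(* Let $\varepsilon>0$ and let $\alpha=(\alpha_0,\alpha_1,\dots)\in\ell^2$. Suppose $$B_{2+\varepsilon}(\alpha):=\sum_{k\ge 0}(k+1)^{2+\varepsilon}|\alpha_k|^2<+\infty.$$ Then the CAR-valued Foguel-Hankel operator $$R(Y_\alpha)=\begin{bmatrix} S^{*(\infty)} & Y_\alpha\\ 0 & S^{(\infty)}\end{bmatrix}$$ is similar to a contraction.
   Context: $H$ is a separable infinite-dimensional complex Hilbert space with inner product $(\cdot,\cdot)$, and $B(H)$ denotes the bounded linear operators on $H$. $\Lambda:H\to B(H)$ is a map satisfying the canonical anticommutation relations (CAR): for all $u,v\in H$, $\Lambda(u)\Lambda(v)+\Lambda(v)\Lambda(u)=0$ and $\Lambda(u)\Lambda(v)^*+\Lambda(v)^*\Lambda(u)=(u,v)I$. $\{e_n\}_{n\ge 0}$ is an orthonormal basis of $H$ and $C_n=\Lambda(e_n)$ for $n\ge 0$. For a sequence $\alpha\in\ell^2$, $Y_\alpha=[\alpha_{i+j}C_{i+j}]_{i,j\ge 0}$ is the CAR-valued Hankel operator acting on $\ell_2(H)$, the Hilbert space of square-summable sequences in $H$ (operator matrices act by $(Xh)_i=\sum_j X_{ij}h_j$). $S^{(\infty)}$ is the unilateral shift on $\ell_2(H)$, $S^{(\infty)}(h_0,h_1,\dots)=(0,h_0,h_1,\dots)$, and $S^{*(\infty)}$ is its adjoint; $R(Y_\alpha)$ acts on $\ell_2(H)\oplus\ell_2(H)$. An operator $T\in B(K)$ is similar to a contraction if there is an invertible $L\in B(K)$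 with $\|L^{-1}TL\|\le 1$. *)

theory Defs
  imports "HOL-Analysis.Analysis"
begin

text \<open>The complex inner product is linear in the first and conjugate-linear in the second
  argument.  Its real part is the real inner product of the library, so that norm, metric and
  topology are those of the class \<^class>\<open>real_inner\<close>.\<close>

class complex_vector = real_vector +
  fixes scaleC :: "complex \<Rightarrow> 'a \<Rightarrow> 'a"  (infixr \<open>*\<^sub>C\<close> 75)
  assumes scaleC_add_right: "a *\<^sub>C (x + y) = a *\<^sub>C x + a *\<^sub>C y"
    and scaleC_add_left: "(a + b) *\<^sub>C x = a *\<^sub>C x + b *\<^sub>C x"
    and scaleC_scaleC: "a *\<^sub>C b *\<^sub>C x = (a * b) *\<^sub>C x"
    and scaleC_of_real: "complex_of_real r *\<^sub>C x = r *\<^sub>R x"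

class complex_inner = complex_vector + real_inner +
  fixes cinner :: "'a \<Rightarrow> 'a \<Rightarrow> complex"
  assumes cinner_commute: "cinner x y = cnj (cinner y x)"
    and cinner_add_left: "cinner (x + y) z = cinner x z + cinner y z"
    and cinner_scaleC_left: "cinner (a *\<^sub>C x) y = a * cinner x y"
    and Re_cinner: "Re (cinner x y) = inner x y"

class complex_hilbert = complex_inner + complete_space

lemma vector_space_scaleC: "vector_space (scaleC :: complex \<Rightarrow> 'a::complex_vector \<Rightarrow> 'a)"
  using scaleC_of_real[of 1]
  by unfold_locales (auto simp: scaleC_add_right scaleC_add_left scaleC_scaleC)

abbreviation cspan :: "'a::complex_vector set \<Rightarrow> 'a set"
  where "cspan \<equiv> module.span scaleC"

lemma norm_scaleC: "norm (a *\<^sub>C x) = cmod a * norm (x::'a::complex_inner)"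
proof -
  have *: "cinner y y = complex_of_real ((norm y)\<^sup>2)" for y :: 'a
    by (rule complex_eqI)
      (use arg_cong[OF cinner_commute[of y y], of Im] in \<open>auto simp: Re_cinner power2_norm_eq_inner\<close>)
  have "cinner (a *\<^sub>C x) (a *\<^sub>C x) = a * cnj (a * cinner x x)"
    by (metis cinner_commute cinner_scaleC_left)
  also have "\<dots> = complex_of_real ((cmod a * norm x)\<^sup>2)"
    by (simp add: * complex_norm_square power_mult_distrib del: of_real_power)
  finally have "(norm (a *\<^sub>C x))\<^sup>2 = (cmod a * norm x)\<^sup>2"
    by (simp only: * of_real_eq_iff)
  then show ?thesis by simp
qed

lemma norm_cinner_le: "cmod (cinner x y) \<le> norm x * norm (y::'a::complex_inner)"
proof (cases "cinner x y = 0")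
  case False
  define a where "a = cnj (cinner x y) / cmod (cinner x y)"
  have a: "cmod a = 1"
    using False by (simp add: a_def norm_divide)
  have "a * cinner x y = cmod (cinner x y)"
    using False by (simp add: a_def complex_norm_square[symmetric] power2_eq_square mult.commute)
  then have "cmod (cinner x y) = inner (a *\<^sub>C x) y"
    by (metis Re_cinner Re_complex_of_real cinner_scaleC_left)
  also have "\<dots> \<le> norm x * norm y"
    using norm_cauchy_schwarz[of "a *\<^sub>C x" y] by (simp add: norm_scaleC a)
  finally show ?thesis .
qed simp

definition bounded_clinear :: "('a::complex_inner \<Rightarrow> 'b::complex_inner) \<Rightarrow> bool"
  where "bounded_clinear f \<longleftrightarrow> bounded_linear f \<and> (\<forall>c x. f (c *\<^sub>C x) = c *\<^sub>C f x)"

text \<open>For bounded complex-linear \<open>f\<close> such a \<open>g\<close> exists by the Riesz representation theorem and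
  is unique; for other functions the value is meaningless.\<close>

definition cadjoint :: "('a::complex_hilbert \<Rightarrow> 'b::complex_hilbert) \<Rightarrow> 'b \<Rightarrow> 'a"
  where "cadjoint f = (THE g. \<forall>x y. cinner (f x) y = cinner x (g y))"

text \<open>Such a sequence exists only in a separable infinite-dimensional space.\<close>

definition orthonormal_basis :: "(nat \<Rightarrow> 'a::complex_inner) \<Rightarrow> bool"
  where "orthonormal_basis e \<longleftrightarrow>
    (\<forall>i j. cinner (e i) (e j) = (if i = j then 1 else 0)) \<and> closure (cspan (range e)) = UNIV"

definition similar_to_contraction :: "('a::complex_hilbert \<Rightarrow> 'a) \<Rightarrow> bool"
  where "similar_to_contraction T \<longleftrightarrow> bounded_clinear T \<and>
    (\<exists>(L :: 'a \<Rightarrow> 'a) (L' :: 'a \<Rightarrow> 'a). bounded_clinear L \<and> bounded_clinear L' \<and> L \<circ> L' = id \<and> L' \<circ> L = id \<and>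
       onorm (L' \<circ> T \<circ> L) \<le> 1)"

instantiation prod :: (complex_vector, complex_vector) complex_vector
begin

definition scaleC_prod_def: "c *\<^sub>C p = (c *\<^sub>C fst p, c *\<^sub>C snd p)"

instance
  by standard
    (auto simp: scaleC_prod_def scaleC_add_right scaleC_add_left scaleC_scaleC scaleC_of_real
      scaleR_prod_def)

end

instantiation prod :: (complex_inner, complex_inner) complex_inner
begin

definition cinner_prod_def: "cinner p q = cinner (fst p) (fst q) + cinner (snd p) (snd q)"

instance
proof
  fix x y z :: "'a \<times> 'b" and a :: complex
  show "cinner x y = cnj (cinner y x)"
    unfolding cinner_prod_def complex_cnj_add
    by (metis cinner_commute)
qed (auto simp: cinner_prod_def scaleC_prod_def cinner_add_left cinner_scaleC_left Re_cinner
      inner_prod_def algebra_simps)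

end

instance prod :: (complex_hilbert, complex_hilbert) complex_hilbert ..

definition block_operator ::
  "('a::complex_inner \<Rightarrow> 'a) \<Rightarrow> ('b::complex_inner \<Rightarrow> 'a) \<Rightarrow> ('a \<Rightarrow> 'b) \<Rightarrow> ('b \<Rightarrow> 'b) \<Rightarrow> 'a \<times> 'b \<Rightarrow> 'a \<times> 'b"
  where "block_operator A B C D = (\<lambda>(x, y). (A x + B y, C x + D y))"

typedef (overloaded) 'a ell2 = "{h :: nat \<Rightarrow> 'a::real_inner. summable (\<lambda>n. (norm (h n))\<^sup>2)}"
  morphisms ell2_nth Abs_ell2
  by (rule exI[of _ "\<lambda>_. 0"]) simp

setup_lifting type_definition_ell2

lemma summable_ell2: "summable (\<lambda>n. (norm (ell2_nth h n))\<^sup>2)"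
  using ell2_nth by blast

lemma ell2_eqI: "(\<And>n. ell2_nth g n = ell2_nth h n) \<Longrightarrow> g = h"
  by (metis ell2_nth_inject ext)

lemma summable_norm_add_sq:
  fixes g h :: "nat \<Rightarrow> 'a::real_inner"
  assumes "summable (\<lambda>n. (norm (g n))\<^sup>2)" "summable (\<lambda>n. (norm (h n))\<^sup>2)"
  shows "summable (\<lambda>n. (norm (g n + h n))\<^sup>2)"
proof (rule summable_comparison_test)
  show "summable (\<lambda>n. 2 * (norm (g n))\<^sup>2 + 2 * (norm (h n))\<^sup>2)"
    by (intro summable_add summable_mult assms)
  have "(norm (x + y))\<^sup>2 \<le> 2 * (norm x)\<^sup>2 + 2 * (norm y)\<^sup>2" for x y :: 'a
  proof -
    have "(norm (x + y))\<^sup>2 \<le> (norm x + norm y)\<^sup>2"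
      by (intro power_mono norm_triangle_ineq norm_ge_zero)
    also have "\<dots> \<le> 2 * (norm x)\<^sup>2 + 2 * (norm y)\<^sup>2"
      using zero_le_power2[of "norm x - norm y"] by (simp add: power2_sum power2_diff)
    finally show ?thesis .
  qed
  then show "\<exists>N. \<forall>n\<ge>N. norm ((norm (g n + h n))\<^sup>2) \<le> 2 * (norm (g n))\<^sup>2 + 2 * (norm (h n))\<^sup>2"
    by simp
qed

lemma summable_inner:
  fixes g h :: "nat \<Rightarrow> 'a::real_inner"
  assumes "summable (\<lambda>n. (norm (g n))\<^sup>2)" "summable (\<lambda>n. (norm (h n))\<^sup>2)"
  shows "summable (\<lambda>n. norm (g n) * norm (h n))"
proof (rule summable_comparison_test)
  show "summable (\<lambda>n. (norm (g n))\<^sup>2 + (norm (h n))\<^sup>2)"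
    by (intro summable_add assms)
  have "a * b \<le> a\<^sup>2 + b\<^sup>2" if "0 \<le> a" "0 \<le> b" for a b :: real
    using sum_squares_bound[of a b] mult_nonneg_nonneg[OF that] by linarith
  then show "\<exists>N. \<forall>n\<ge>N. norm (norm (g n) * norm (h n)) \<le> (norm (g n))\<^sup>2 + (norm (h n))\<^sup>2"
    by simp
qed

instantiation ell2 :: (real_inner) real_vector
begin

lift_definition zero_ell2 :: "'a ell2" is "\<lambda>_. 0" by simp

lift_definition plus_ell2 :: "'a ell2 \<Rightarrow> 'a ell2 \<Rightarrow> 'a ell2" is "\<lambda>g h n. g n + h n"
  by (rule summable_norm_add_sq)

lift_definition uminus_ell2 :: "'a ell2 \<Rightarrow> 'a ell2" is "\<lambda>h n. - h n" by simp

lift_definition minus_ell2 :: "'a ell2 \<Rightarrow> 'a ell2 \<Rightarrow> 'a ell2" is "\<lambda>g h n. g n - h n"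
  using summable_norm_add_sq[of _ "\<lambda>n. - h n" for h] by fastforce

lift_definition scaleR_ell2 :: "real \<Rightarrow> 'a ell2 \<Rightarrow> 'a ell2" is "\<lambda>r h n. r *\<^sub>R h n"
  by (simp add: power_mult_distrib summable_mult)

instance
  by standard (transfer; simp add: algebra_simps)+

end

instantiation ell2 :: (real_inner) real_inner
begin

lift_definition inner_ell2 :: "'a ell2 \<Rightarrow> 'a ell2 \<Rightarrow> real" is "\<lambda>g h. \<Sum>n. inner (g n) (h n)" .

definition norm_ell2 :: "'a ell2 \<Rightarrow> real" where "norm_ell2 h = sqrt (inner h h)"

definition sgn_ell2 :: "'a ell2 \<Rightarrow> 'a ell2" where "sgn_ell2 h = h /\<^sub>R norm h"

definition dist_ell2 :: "'a ell2 \<Rightarrow> 'a ell2 \<Rightarrow> real" where "dist_ell2 g h = norm (g - h)"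

definition uniformity_ell2 :: "('a ell2 \<times> 'a ell2) filter"
  where "uniformity_ell2 = (INF e\<in>{0<..}. principal {(x, y). dist x y < e})"

definition open_ell2 :: "'a ell2 set \<Rightarrow> bool"
  where "open_ell2 U \<longleftrightarrow> (\<forall>x\<in>U. \<forall>\<^sub>F (x', y) in uniformity. x' = x \<longrightarrow> y \<in> U)"

lemma summable_inner_ell2: "summable (\<lambda>n. inner (ell2_nth g n) (ell2_nth h n))"
  by (rule summable_comparison_test[OF _ summable_inner[OF summable_ell2[of g] summable_ell2[of h]]])
    (simp add: Cauchy_Schwarz_ineq2)

instance
proof
  fix x y z :: "'a ell2" and r :: real
  show "inner x y = inner y x"
    by transfer (simp add: inner_commute)
  show "inner (x + y) z = inner x z + inner y z"
    using suminf_add[OF summable_inner_ell2[of x z] summable_inner_ell2[of y z]]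
    by (simp add: inner_ell2.rep_eq plus_ell2.rep_eq inner_add_left)
  show "inner (r *\<^sub>R x) y = r * inner x y"
    using suminf_mult[OF summable_inner_ell2[of x y], of r]
    by (simp add: inner_ell2.rep_eq scaleR_ell2.rep_eq)
  show "0 \<le> inner x x"
    using suminf_nonneg[OF summable_inner_ell2[of x x]] by (simp add: inner_ell2.rep_eq)
  show "inner x x = 0 \<longleftrightarrow> x = 0"
    using suminf_eq_zero_iff[OF summable_inner_ell2[of x x]]
    by (auto simp: inner_ell2.rep_eq zero_ell2.rep_eq intro: ell2_eqI)
qed (fact norm_ell2_def sgn_ell2_def dist_ell2_def uniformity_ell2_def open_ell2_def)+

end

lemma norm_ell2_sq: "(norm h)\<^sup>2 = (\<Sum>n. (norm (ell2_nth h n))\<^sup>2)"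
  by (simp add: power2_norm_eq_inner inner_ell2.rep_eq)

lemma sum_norm_ell2_le: "(\<Sum>n<M. (norm (ell2_nth h n))\<^sup>2) \<le> (norm h)\<^sup>2"
  unfolding norm_ell2_sq by (rule sum_le_suminf[OF summable_ell2]) auto

lemma norm_ell2_nth_le: "norm (ell2_nth h n) \<le> norm h"
proof -
  have "(norm (ell2_nth h n))\<^sup>2 \<le> (\<Sum>i<Suc n. (norm (ell2_nth h i))\<^sup>2)"
    by (simp add: sum_nonneg)
  also have "\<dots> \<le> (norm h)\<^sup>2"
    by (rule sum_norm_ell2_le)
  finally show ?thesis
    by (simp add: power2_le_iff_abs_le)
qed

instance ell2 :: ("{real_inner, complete_space}") complete_space
proof
  fix X :: "nat \<Rightarrow> 'a ell2"
  assume X: "Cauchy X"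
  have "convergent (\<lambda>m. ell2_nth (X m) n)" for n
  proof (rule Cauchy_convergent, rule metric_CauchyI)
    fix e :: real
    assume "0 < e"
    then obtain N where "\<forall>m\<ge>N. \<forall>k\<ge>N. dist (X m) (X k) < e"
      using X by (meson metric_CauchyD)
    then show "\<exists>N. \<forall>m\<ge>N. \<forall>k\<ge>N. dist (ell2_nth (X m) n) (ell2_nth (X k) n) < e"
      unfolding dist_norm
      by (metis (no_types, lifting) minus_ell2.rep_eq norm_ell2_nth_le le_less_trans)
  qed
  then obtain l where l: "\<And>n. (\<lambda>m. ell2_nth (X m) n) \<longlonglongrightarrow> l n"
    unfolding convergent_def by metis
  have bound: "\<exists>N. \<forall>m\<ge>N. \<forall>M. (\<Sum>n<M. (norm (ell2_nth (X m) n - l n))\<^sup>2) \<le> e\<^sup>2" if "0 < e" for e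
  proof -
    obtain N where N: "\<And>m k. m \<ge> N \<Longrightarrow> k \<ge> N \<Longrightarrow> norm (X m - X k) < e"
      using X \<open>0 < e\<close> unfolding dist_norm[symmetric] by (meson metric_CauchyD)
    have "(\<Sum>n<M. (norm (ell2_nth (X m) n - l n))\<^sup>2) \<le> e\<^sup>2" if "m \<ge> N" for m M
    proof (rule LIMSEQ_le_const2)
      show "(\<lambda>k. \<Sum>n<M. (norm (ell2_nth (X m) n - ell2_nth (X k) n))\<^sup>2)
          \<longlonglongrightarrow> (\<Sum>n<M. (norm (ell2_nth (X m) n - l n))\<^sup>2)"
        by (intro tendsto_intros l)
      have "(\<Sum>n<M. (norm (ell2_nth (X m) n - ell2_nth (X k) n))\<^sup>2) \<le> e\<^sup>2" if "k \<ge> N" for k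
      proof -
        have "(norm (X m - X k))\<^sup>2 \<le> e\<^sup>2"
          using N[OF \<open>m \<ge> N\<close> that] by (intro power_mono) auto
        then show ?thesis
          using sum_norm_ell2_le[of "X m - X k" M] by (simp add: minus_ell2.rep_eq)
      qed
      then show "\<exists>N. \<forall>k\<ge>N. (\<Sum>n<M. (norm (ell2_nth (X m) n - ell2_nth (X k) n))\<^sup>2) \<le> e\<^sup>2"
        by blast
    qed
    then show ?thesis by blast
  qed
  have summable_diff: "summable (\<lambda>n. (norm (ell2_nth (X m) n - l n))\<^sup>2)"
    if "\<forall>M. (\<Sum>n<M. (norm (ell2_nth (X m) n - l n))\<^sup>2) \<le> C" for m C
    by (rule summableI_nonneg_bounded[where x = C]) (use that in auto)
  obtain m C where mC: "\<forall>M. (\<Sum>n<M. (norm (ell2_nth (X m) n - l n))\<^sup>2) \<le> C"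
    using bound[of 1] by force
  have "summable (\<lambda>n. (norm (ell2_nth (- X m) n + (ell2_nth (X m) n - l n)))\<^sup>2)"
    by (intro summable_norm_add_sq summable_ell2 summable_diff[OF mC])
  then have "summable (\<lambda>n. (norm (l n))\<^sup>2)"
    by (simp add: uminus_ell2.rep_eq)
  then have L: "ell2_nth (Abs_ell2 l) = l"
    by (simp add: Abs_ell2_inverse)
  have "X \<longlonglongrightarrow> Abs_ell2 l"
  proof (rule metric_LIMSEQ_I)
    fix e :: real
    assume "0 < e"
    then obtain N where N: "\<forall>m\<ge>N. \<forall>M. (\<Sum>n<M. (norm (ell2_nth (X m) n - l n))\<^sup>2) \<le> (e / 2)\<^sup>2"
      using bound[of "e / 2"] by auto
    have "dist (X m) (Abs_ell2 l) < e" if "m \<ge> N" for m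
    proof -
      have "(norm (X m - Abs_ell2 l))\<^sup>2 \<le> (e / 2)\<^sup>2"
        unfolding norm_ell2_sq minus_ell2.rep_eq L
        by (rule suminf_le_const) (use N that summable_diff in auto)
      then have "norm (X m - Abs_ell2 l) \<le> e / 2"
        using \<open>0 < e\<close> by (simp add: power2_le_iff_abs_le)
      then show ?thesis
        using \<open>0 < e\<close> by (simp add: dist_norm)
    qed
    then show "\<exists>N. \<forall>m\<ge>N. dist (X m) (Abs_ell2 l) < e" by blast
  qed
  then show "convergent X" by (rule convergentI)
qed

instantiation ell2 :: (complex_inner) complex_vector
begin

lift_definition scaleC_ell2 :: "complex \<Rightarrow> 'a ell2 \<Rightarrow> 'a ell2" is "\<lambda>c h n. c *\<^sub>C h n"
  by (simp add: norm_scaleC power_mult_distrib summable_mult)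

instance
  by standard
    (transfer; simp add: scaleC_add_right scaleC_add_left scaleC_scaleC scaleC_of_real)+

end

instantiation ell2 :: (complex_inner) complex_inner
begin

lift_definition cinner_ell2 :: "'a ell2 \<Rightarrow> 'a ell2 \<Rightarrow> complex" is "\<lambda>g h. \<Sum>n. cinner (g n) (h n)" .

lemma summable_cinner_ell2: "summable (\<lambda>n. cinner (ell2_nth g n) (ell2_nth h n))"
proof (rule summable_comparison_test)
  show "summable (\<lambda>n. norm (ell2_nth g n) * norm (ell2_nth h n))"
    by (intro summable_inner summable_ell2)
  show "\<exists>N. \<forall>n\<ge>N. norm (cinner (ell2_nth g n) (ell2_nth h n)) \<le> norm (ell2_nth g n) * norm (ell2_nth h n)"
    by (simp add: norm_cinner_le)
qed

instance
proof
  fix x y z :: "'a ell2" and a :: complex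
  have "(\<lambda>n. cinner (ell2_nth x n) (ell2_nth y n)) sums cinner x y" for x y :: "'a ell2"
    unfolding cinner_ell2.rep_eq by (rule summable_sums[OF summable_cinner_ell2])
  note sums = this
  have "(\<lambda>n. cinner (ell2_nth x n) (ell2_nth y n)) sums cnj (cinner y x)"
    by (subst cinner_commute) (use sums[of y x] in \<open>simp add: sums_cnj\<close>)
  then show "cinner x y = cnj (cinner y x)"
    using sums sums_unique2 by blast
  show "cinner (x + y) z = cinner x z + cinner y z"
    using sums_add[OF sums[of x z] sums[of y z]] sums[of "x + y" z] sums_unique2
    by (fastforce simp: plus_ell2.rep_eq cinner_add_left)
  show "cinner (a *\<^sub>C x) y = a * cinner x y"
    using sums_mult[OF sums[of x y], of a] sums[of "a *\<^sub>C x" y] sums_unique2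
    by (fastforce simp: scaleC_ell2.rep_eq cinner_scaleC_left)
  show "Re (cinner x y) = inner x y"
    using sums_Re[OF sums[of x y]] by (simp add: Re_cinner inner_ell2.rep_eq sums_iff)
qed

end

instance ell2 :: (complex_hilbert) complex_hilbert ..

lift_definition shift :: "'a::real_inner ell2 \<Rightarrow> 'a ell2"
  is "\<lambda>h n. case n of 0 \<Rightarrow> 0 | Suc m \<Rightarrow> h m"
  by (subst summable_Suc_iff[symmetric]) simp

text \<open>The matrix \<open>X\<close> is meant to define an operator, that is, for every \<open>h\<close> the series in the
  definition converge and their sums form a square-summable sequence.\<close>

definition matrix_operator ::
  "(nat \<Rightarrow> nat \<Rightarrow> 'a::real_inner \<Rightarrow> 'a) \<Rightarrow> 'a ell2 \<Rightarrow> 'a ell2"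
  where "matrix_operator X h = Abs_ell2 (\<lambda>i. \<Sum>j. X i j (ell2_nth h j))"

definition canonical_anticommutation ::
  "('a::complex_hilbert \<Rightarrow> 'a \<Rightarrow> 'a) \<Rightarrow> bool"
  where "canonical_anticommutation \<Lambda> \<longleftrightarrow>
    (\<forall>u. bounded_clinear (\<Lambda> u)) \<and>
    (\<forall>u v x. \<Lambda> u (\<Lambda> v x) + \<Lambda> v (\<Lambda> u x) = 0) \<and>
    (\<forall>u v x. \<Lambda> u (cadjoint (\<Lambda> v) x) + cadjoint (\<Lambda> v) (\<Lambda> u x) = cinner u v *\<^sub>C x)"

text \<open>For square-summable \<open>\<alpha>\<close> this matrix always defines a bounded operator: it is the Hankel
  matrix of the bounded symbol \<open>z \<mapsto> \<Lambda> (\<Sum>k. \<alpha> k * z ^ k * e k)\<close>.\<close>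

definition car_hankel ::
  "('a::complex_hilbert \<Rightarrow> 'a \<Rightarrow> 'a) \<Rightarrow> (nat \<Rightarrow> 'a) \<Rightarrow> (nat \<Rightarrow> complex) \<Rightarrow> 'a ell2 \<Rightarrow> 'a ell2"
  where "car_hankel \<Lambda> e \<alpha> = matrix_operator (\<lambda>i j x. \<alpha> (i + j) *\<^sub>C \<Lambda> (e (i + j)) x)"

definition foguel_hankel ::
  "('a::complex_hilbert ell2 \<Rightarrow> 'a ell2) \<Rightarrow> 'a ell2 \<times> 'a ell2 \<Rightarrow> 'a ell2 \<times> 'a ell2"
  where "foguel_hankel Y = block_operator (cadjoint shift) Y (\<lambda>_. 0) shift"

end

theory Submission
  imports Defs
begin

text \<open>Write \<open>S\<close> for the shift on \<open>\<ell>\<^sup>2(H)\<close> and \<open>Y\<close> for the Hankel operator.  If a bounded \<open>X\<close> solves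
  \<open>Y = S\<^sup>* X - X S\<close>, then conjugating the operator matrix by the unipotent matrix with corner
  \<open>-X\<close> removes \<open>Y\<close> and leaves the contraction \<open>S\<^sup>* \<oplus> S\<close>
  (\<open>similar_to_contraction_block_operator\<close>).  The Hankel property is \<open>Y S = S\<^sup>* Y\<close>, and since
  \<open>S\<^sup>* S = I\<close> it makes \<open>X = (\<Sum>m. S\<^sup>m\<^sup>+\<^sup>1 S\<^sup>*\<^sup>m Y)\<close> a telescoping solution, provided
  that the norms of \<open>S\<^sup>*\<^sup>m Y\<close> are summable (\<open>sylvester_solution\<close>).

  The matrix of \<open>S\<^sup>*\<^sup>m Y\<close> involves the coefficients \<open>\<alpha>\<^sub>k\<close> with \<open>k \<ge> m\<close> only.  The anticommutation
  relations bound the norm of a Hankel operator by the \<open>\<ell>\<^sup>2\<close> norm of its coefficients: for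
  \<open>L = (\<Sum>k. \<alpha>\<^sub>k U\<^sup>k C\<^sub>k)\<close> with the bilateral shift \<open>U\<close>, the relations collapse
  \<open>L\<^sup>* L + L L\<^sup>*\<close> to the scalar \<open>\<Sum>k. \<bar>\<alpha>\<^sub>k\<bar>\<^sup>2\<close>, and the Hankel matrix is a corner of \<open>L\<close> up to a
  reversal of the order of the rows (\<open>norm_hankel_finite\<close>).  Hence the norm of \<open>S\<^sup>*\<^sup>m Y\<close> is at most
  the square root of \<open>\<Sum>k\<ge>m. \<bar>\<alpha>\<^sub>k\<bar>\<^sup>2\<close>, and this is
  at most a constant times \<open>(m + 1)\<close> to the power \<open>-1 - \<epsilon>/2\<close>, which is summable
  (\<open>norm_unshift_hankel_le\<close>).\<close>

text \<open>Makes absolutely convergent series in Hilbert spaces available.\<close>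

instance complex_hilbert \<subseteq> banach ..

section \<open>Complex inner products and bounded complex-linear maps\<close>

lemma cinner_add_right: "cinner x (y + z) = cinner x y + cinner x (z::'a::complex_inner)"
  by (metis cinner_commute cinner_add_left complex_cnj_add)

lemma cinner_scaleC_right: "cinner x (c *\<^sub>C y) = cnj c * cinner x (y::'a::complex_inner)"
  by (metis cinner_commute cinner_scaleC_left complex_cnj_mult)

lemma cinner_zero_left [simp]: "cinner 0 (y::'a::complex_inner) = 0"
  using cinner_add_left[of 0 0 y] by simp

lemma cinner_zero_right [simp]: "cinner y (0::'a::complex_inner) = 0"
  using cinner_add_right[of y 0 0] by simp

lemma cinner_sum_left: "cinner (\<Sum>k\<in>A. f k) (y::'a::complex_inner) = (\<Sum>k\<in>A. cinner (f k) y)"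
  by (induction A rule: infinite_finite_induct) (auto simp: cinner_add_left)

lemma cinner_sum_right: "cinner (y::'a::complex_inner) (\<Sum>k\<in>A. f k) = (\<Sum>k\<in>A. cinner y (f k))"
  by (induction A rule: infinite_finite_induct) (auto simp: cinner_add_right)

lemma cinner_self: "cinner x (x::'a::complex_inner) = complex_of_real ((norm x)\<^sup>2)"
  by (rule complex_eqI)
    (use arg_cong[OF cinner_commute[of x x], of Im] in \<open>auto simp: Re_cinner power2_norm_eq_inner\<close>)

text \<open>Carries adjointness for the real inner product over to the complex one.\<close>

lemma cinner_eq_complex: "cinner x (y::'a::complex_inner) = Complex (inner x y) (- inner (\<i> *\<^sub>C x) y)"
  by (rule complex_eqI) (simp_all add: Re_cinner[symmetric] cinner_scaleC_left)

lemma scaleC_zero_right [simp]: "c *\<^sub>C (0::'a::complex_vector) = 0"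
  using scaleC_add_right[of c 0 "0::'a"] by simp

lemma scaleC_uminus_right: "c *\<^sub>C (- x) = - (c *\<^sub>C (x::'a::complex_vector))"
  using scaleC_add_right[of c x "- x"] by (simp add: eq_neg_iff_add_eq_0 add.commute)

lemma bounded_linear_scaleC_right: "bounded_linear (\<lambda>x::'a::complex_inner. c *\<^sub>C x)"
proof
  fix x y :: 'a and r :: real
  show "c *\<^sub>C (x + y) = c *\<^sub>C x + c *\<^sub>C y" by (rule scaleC_add_right)
  show "c *\<^sub>C (r *\<^sub>R x) = r *\<^sub>R (c *\<^sub>C x)"
    by (metis scaleC_of_real scaleC_scaleC mult.commute)
  show "\<exists>K. \<forall>x::'a. norm (c *\<^sub>C x) \<le> norm x * K"
    by (metis norm_scaleC mult.commute order_refl)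
qed

lemma bounded_clinearI:
  assumes "\<And>x y. f (x + y) = f x + f y" "\<And>c x. f (c *\<^sub>C x) = c *\<^sub>C f x"
    and "\<And>x. norm (f x) \<le> K * norm x"
  shows "bounded_clinear f"
proof -
  have "f (r *\<^sub>R x) = r *\<^sub>R f x" for r x
    using assms(2)[of "complex_of_real r" x] by (simp add: scaleC_of_real)
  then have "bounded_linear f"
    by (intro bounded_linear_intro[where K = K]) (use assms in \<open>auto simp: mult.commute\<close>)
  then show ?thesis
    using assms(2) by (simp add: bounded_clinear_def)
qed

lemma bounded_clinear_block_operator:
  assumes "bounded_clinear A" "bounded_clinear B" "bounded_clinear C" "bounded_clinear D"
  shows "bounded_clinear (block_operator A B C D)"
proof -
  have lin: "bounded_linear A" "bounded_linear B" "bounded_linear C" "bounded_linear D"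
    using assms by (auto simp: bounded_clinear_def)
  have "bounded_linear (\<lambda>p. (A (fst p) + B (snd p), C (fst p) + D (snd p)))"
    by (intro bounded_linear_Pair bounded_linear_add bounded_linear_compose[OF lin(1)]
        bounded_linear_compose[OF lin(2)] bounded_linear_compose[OF lin(3)]
        bounded_linear_compose[OF lin(4)] bounded_linear_fst bounded_linear_snd)
  moreover have "block_operator A B C D = (\<lambda>p. (A (fst p) + B (snd p), C (fst p) + D (snd p)))"
    by (auto simp: block_operator_def)
  ultimately show ?thesis
    using assms unfolding bounded_clinear_def by (auto simp: scaleC_prod_def scaleC_add_right)
qed

lemma bounded_clinear_id: "bounded_clinear (\<lambda>x. x)"
  by (rule bounded_clinearI[where K = 1]) auto

lemma bounded_clinear_zero: "bounded_clinear (\<lambda>x. 0)"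
  by (rule bounded_clinearI[where K = 0]) auto

lemma bounded_clinear_uminus: "bounded_clinear f \<Longrightarrow> bounded_clinear (\<lambda>x. - f x)"
  by (auto simp: bounded_clinear_def bounded_linear_minus scaleC_uminus_right)

section \<open>Adjoints\<close>

text \<open>The representing vector minimizes \<open>Q x = \<parallel>x\<parallel>\<^sup>2 - 2 f x\<close>: by the parallelogram law every minimizing
  sequence is Cauchy, and the first variation of \<open>Q\<close> at a minimizer \<open>x\<close> in direction \<open>y\<close> is
  \<open>2 (inner x y - f y)\<close>.\<close>

theorem riesz_representation:
  fixes f :: "'a::{real_inner, complete_space} \<Rightarrow> real"
  assumes f: "bounded_linear f"
  obtains x where "\<And>y. f y = inner x y"
proof -
  interpret f: bounded_linear f by (rule f)
  define Q where "Q x = (norm x)\<^sup>2 - 2 * f x" for x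
  obtain K where K: "\<And>x. norm (f x) \<le> norm x * K"
    using f.bounded by blast
  have "- K\<^sup>2 \<le> Q x" for x
  proof -
    have "f x \<le> norm x * K" using K[of x] by auto
    moreover have "0 \<le> (norm x - K)\<^sup>2" by simp
    ultimately show ?thesis
      by (simp add: Q_def power2_diff)
  qed
  then have bdd: "bdd_below (range Q)"
    by (auto simp: bdd_below_def)
  define m where "m = Inf (range Q)"
  have m_le: "m \<le> Q x" for x
    unfolding m_def by (intro cInf_lower bdd) simp
  have "\<exists>x. Q x < m + 1 / real (Suc n)" for n
    using cInf_lessD[of "range Q" "m + 1 / real (Suc n)"] by (auto simp: m_def)
  then obtain X where X: "\<And>n. Q (X n) < m + 1 / real (Suc n)"
    by metis
  have dist: "(norm (x - y))\<^sup>2 \<le> 2 * (Q x - m) + 2 * (Q y - m)" for x y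
  proof -
    have "Q x + Q y = 2 * Q ((1 / 2) *\<^sub>R (x + y)) + (norm (x - y))\<^sup>2 / 2"
      by (simp add: Q_def f.scaleR f.add power2_norm_eq_inner inner_add_left inner_add_right
          inner_diff_left inner_diff_right inner_commute field_simps)
    then show ?thesis
      using m_le[of "(1 / 2) *\<^sub>R (x + y)"] by argo
  qed
  have "Cauchy X"
  proof (rule metric_CauchyI)
    fix r :: real
    assume "0 < r"
    then obtain N where N: "1 / real (Suc N) < r\<^sup>2 / 4"
      using reals_Archimedean[of "r\<^sup>2 / 4"] by (auto simp: inverse_eq_divide)
    have "dist (X i) (X j) < r" if "i \<ge> N" "j \<ge> N" for i j
    proof -
      have "Q (X n) - m < r\<^sup>2 / 4" if "n \<ge> N" for n
      proof -
        have "1 / real (Suc n) \<le> 1 / real (Suc N)"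
          using that by (simp add: frac_le)
        then show ?thesis using X[of n] N by linarith
      qed
      from this[OF that(1)] this[OF that(2)] have "(norm (X i - X j))\<^sup>2 < r\<^sup>2"
        using dist[of "X i" "X j"] by argo
      then show ?thesis
        using \<open>0 < r\<close> by (simp add: dist_norm power_less_imp_less_base)
    qed
    then show "\<exists>N. \<forall>i\<ge>N. \<forall>j\<ge>N. dist (X i) (X j) < r" by blast
  qed
  then obtain x where x: "X \<longlonglongrightarrow> x"
    using Cauchy_convergent convergent_def by blast
  have "Q x \<le> m"
  proof (rule LIMSEQ_le)
    show "(\<lambda>n. Q (X n)) \<longlonglongrightarrow> Q x"
      unfolding Q_def by (intro tendsto_intros f.tendsto x)
    show "(\<lambda>n. m + 1 / real (Suc n)) \<longlonglongrightarrow> m"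
      using tendsto_add[OF tendsto_const[of m] LIMSEQ_inverse_real_of_nat]
      by (simp add: inverse_eq_divide)
    show "\<exists>N. \<forall>n\<ge>N. Q (X n) \<le> m + 1 / real (Suc n)"
      using X less_imp_le by blast
  qed
  have "f y = inner x y" for y
  proof (cases "y = 0")
    case False
    \<comment> \<open>The step \<open>t\<close> minimizes the quadratic \<open>t \<mapsto> Q (x + t y)\<close>, which would drop below \<open>Q x\<close> for \<open>c \<noteq> 0\<close>.\<close>
    define c t where "c = inner x y - f y" and "t = - c / (norm y)\<^sup>2"
    have t: "t * (norm y)\<^sup>2 = - c"
      using False by (simp add: t_def)
    have "Q x \<le> Q (x + t *\<^sub>R y)"
      using \<open>Q x \<le> m\<close> m_le order_trans by blast
    also have "\<dots> = Q x + t * (t * (norm y)\<^sup>2) + 2 * t * c"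
      by (simp add: Q_def c_def f.scaleR f.add power2_norm_eq_inner inner_add_left inner_add_right
          inner_commute field_simps)
    finally have "0 \<le> t * c"
      unfolding t by (simp add: mult.commute)
    then have "c\<^sup>2 / (norm y)\<^sup>2 \<le> 0"
      by (simp add: t_def power2_eq_square)
    then have "c = 0"
      using False by (simp add: divide_le_0_iff)
    then show ?thesis by (simp add: c_def)
  qed (simp add: f.zero)
  then show ?thesis by (rule that)
qed

lemma cadjoint_eqI:
  fixes f :: "'a::complex_hilbert \<Rightarrow> 'b::complex_hilbert"
  assumes "\<And>x y. cinner (f x) y = cinner x (g y)"
  shows "cadjoint f = g"
  unfolding cadjoint_def
proof (rule the_equality)
  show "\<forall>x y. cinner (f x) y = cinner x (g y)" using assms by blast
  fix g'
  assume g': "\<forall>x y. cinner (f x) y = cinner x (g' y)"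
  show "g' = g"
  proof
    fix y
    have "inner x (g' y) = inner x (g y)" for x
      using g' assms by (metis Re_cinner)
    then show "g' y = g y"
      by (metis vector_eq_ldot)
  qed
qed

lemma cinner_cadjoint:
  fixes f :: "'a::complex_hilbert \<Rightarrow> 'b::complex_hilbert"
  assumes f: "bounded_clinear f"
  shows "cinner (f x) y = cinner x (cadjoint f y)"
proof -
  have lin: "bounded_linear f" and C: "\<And>c x. f (c *\<^sub>C x) = c *\<^sub>C f x"
    using f by (auto simp: bounded_clinear_def)
  have "\<exists>z. \<forall>x. inner (f x) y = inner x z" for y
  proof -
    have "bounded_linear (\<lambda>x. inner (f x) y)"
      by (rule bounded_linear_compose[OF bounded_linear_inner_left lin])
    then show ?thesis
      by (metis riesz_representation inner_commute)
  qed
  then obtain g where g: "\<And>x y. inner (f x) y = inner x (g y)"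
    by metis
  have "cinner (f x) y = cinner x (g y)" for x y
    by (simp add: cinner_eq_complex g flip: C)
  moreover from this have "cadjoint f = g"
    by (rule cadjoint_eqI)
  ultimately show ?thesis by simp
qed

section \<open>Hankel operators over a sequence satisfying the anticommutation relations\<close>

lemma sum_int_shift:
  fixes F :: "int \<Rightarrow> 'a::comm_monoid_add"
  assumes "\<And>n. F n \<noteq> 0 \<Longrightarrow> 0 \<le> n \<and> n \<le> W" and "0 \<le> s" "s \<le> W"
  shows "(\<Sum>n\<in>{-W..W}. F (n + s)) = (\<Sum>n\<in>{-W..W}. F n)"
proof -
  have F0: "F n = 0" if "\<not> (0 \<le> n \<and> n \<le> W)" for n
    using assms(1) that by blast
  have "(\<Sum>n\<in>{-W..W}. F (n + s)) = (\<Sum>n\<in>{-W+s..W+s}. F n)"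
    by (rule sum.reindex_bij_witness[where i = "\<lambda>n. n - s" and j = "\<lambda>n. n + s"]) auto
  also have "\<dots> = (\<Sum>n\<in>{0..W}. F n)"
    by (rule sum.mono_neutral_right) (use assms(2,3) in \<open>auto intro!: F0\<close>)
  also have "\<dots> = (\<Sum>n\<in>{-W..W}. F n)"
    by (rule sum.mono_neutral_left) (use assms(2,3) in \<open>auto intro!: F0\<close>)
  finally show ?thesis .
qed

text \<open>In the application \<open>C k\<close> is the field operator at the \<open>k\<close>-th basis vector.  The adjoints \<open>D k\<close> are a
  parameter so that the computations use the adjoint relation in place of \<^const>\<open>cadjoint\<close>.\<close>

locale car_sequence =
  fixes C D :: "nat \<Rightarrow> 'h::complex_hilbert \<Rightarrow> 'h"
  assumes clinear: "bounded_clinear (C k)"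
    and adjoint: "cinner (C k x) y = cinner x (D k y)"
    and anticommute: "C k (D l x) + D l (C k x) = (if k = l then x else 0)"
begin

lemma linear: "bounded_linear (C k)"
  using clinear by (simp add: bounded_clinear_def)

lemma C_zero [simp]: "C k 0 = 0"
  using linear bounded_linear.linear linear_0 by blast

lemma adjoint': "cinner x (C k y) = cinner (D k x) y"
  by (metis adjoint cinner_commute)

text \<open>\<open>C\<^sup>* C + C C\<^sup>* = I\<close> is a sum of two positive operators.\<close>

lemma norm_C_le: "norm (C k x) \<le> norm x"
proof -
  have "cinner (C k x) (C k x) + cinner (D k x) (D k x) = cinner x x"
    by (metis adjoint adjoint' anticommute cinner_add_left add.commute)
  then have "(norm (C k x))\<^sup>2 + (norm (D k x))\<^sup>2 = (norm x)\<^sup>2"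
    unfolding cinner_self by (metis of_real_add of_real_eq_iff)
  then show ?thesis
    by (smt (verit) norm_ge_zero power2_le_imp_le zero_le_power2)
qed

text \<open>Put \<open>h\<close> on \<open>\<int>\<close> as a finitely supported sequence \<open>g\<close> and let
  \<open>(A g)\<^sub>n = (\<Sum>k. a\<^sub>k C\<^sub>k g\<^sub>n\<^sub>+\<^sub>k)\<close>, whose adjoint is \<open>(B g)\<^sub>n = (\<Sum>k. cnj a\<^sub>k C\<^sub>k\<^sup>* g\<^sub>n\<^sub>-\<^sub>k)\<close>.
  Translations commute with everything, so after a shift of the summation index in \<open>\<parallel>B g\<parallel>\<^sup>2\<close> the
  cross terms of \<open>\<parallel>A g\<parallel>\<^sup>2 + \<parallel>B g\<parallel>\<^sup>2\<close> contain anticommutators.  Only the diagonal survives, and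
  the sum equals \<open>\<parallel>a\<parallel>\<^sup>2 \<parallel>g\<parallel>\<^sup>2\<close>.  Row \<open>i\<close> of the Hankel matrix is \<open>(A g)\<^sub>-\<^sub>i\<close>.\<close>

lemma norm_hankel_finite:
  "(\<Sum>i<N. (norm (\<Sum>j<N. a (i + j) *\<^sub>C C (i + j) (h j)))\<^sup>2)
    \<le> (\<Sum>k<2*N. (cmod (a k))\<^sup>2) * (\<Sum>j<N. (norm (h j))\<^sup>2)"
proof -
  define M where "M = 2 * N"
  \<comment> \<open>The window \<open>I\<close> is so large that no translation by at most \<open>2 * M\<close> moves a support out of it.\<close>
  define W where "W = int (5 * N)"
  define I where "I = {-W..W}"
  define g where "g n = (if 0 \<le> n \<and> n < int N then h (nat n) else 0)" for n :: int
  have g0: "0 \<le> n \<and> n < int N" if "g n \<noteq> 0" for n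
    using that by (auto simp: g_def split: if_splits)
  define A where "A n = (\<Sum>k<M. a k *\<^sub>C C k (g (n + int k)))" for n
  define B where "B n = (\<Sum>k<M. cnj (a k) *\<^sub>C D k (g (n - int k)))" for n
  have "(\<Sum>n\<in>I. cinner (A n) (A n)) =
      (\<Sum>n\<in>I. \<Sum>k<M. \<Sum>l<M. a k * cnj (a l) * cinner (D l (C k (g (n + int k)))) (g (n + int l)))"
    unfolding A_def cinner_sum_left
    unfolding cinner_sum_right cinner_scaleC_left cinner_scaleC_right
    by (simp only: adjoint' mult.assoc mult.left_commute)
  also have "\<dots> = (\<Sum>k<M. \<Sum>l<M. a k * cnj (a l) *
      (\<Sum>n\<in>I. cinner (D l (C k (g (n + int k)))) (g (n + int l))))"
    unfolding sum_distrib_left by (subst sum.swap, rule sum.cong[OF refl], subst sum.swap) simp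
  finally have sA: "(\<Sum>n\<in>I. cinner (A n) (A n)) = \<dots>" .
  have "(\<Sum>n\<in>I. cinner (B n) (B n)) =
      (\<Sum>n\<in>I. \<Sum>l<M. \<Sum>k<M. a k * cnj (a l) * cinner (C k (D l (g (n - int l)))) (g (n - int k)))"
    unfolding B_def cinner_sum_left
    unfolding cinner_sum_right cinner_scaleC_left cinner_scaleC_right
    by (simp only: adjoint[symmetric] complex_cnj_cnj mult.assoc mult.left_commute)
  also have "\<dots> = (\<Sum>k<M. \<Sum>l<M. a k * cnj (a l) *
      (\<Sum>n\<in>I. cinner (C k (D l (g (n - int l)))) (g (n - int k))))"
    unfolding sum_distrib_left
    by (subst sum.swap, subst (2) sum.swap, subst sum.swap) simp
  also have "\<dots> = (\<Sum>k<M. \<Sum>l<M. a k * cnj (a l) *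
      (\<Sum>n\<in>I. cinner (C k (D l (g (n + int k)))) (g (n + int l))))"
  proof (rule sum.cong[OF refl], rule sum.cong[OF refl], rule arg_cong2[where f = "(*)", OF refl])
    fix k l
    assume kl: "k \<in> {..<M}" "l \<in> {..<M}"
    have "(\<Sum>n\<in>I. (\<lambda>n. cinner (C k (D l (g (n - int l)))) (g (n - int k))) (n + int (k + l)))
        = (\<Sum>n\<in>I. cinner (C k (D l (g (n - int l)))) (g (n - int k)))"
      unfolding I_def
    proof (rule sum_int_shift)
      fix n
      assume "cinner (C k (D l (g (n - int l)))) (g (n - int k)) \<noteq> 0"
      then have "g (n - int k) \<noteq> 0"
        by auto
      from g0[OF this] show "0 \<le> n \<and> n \<le> W"
        using kl by (auto simp: W_def M_def)
    qed (use kl in \<open>auto simp: W_def M_def\<close>)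
    then show "(\<Sum>n\<in>I. cinner (C k (D l (g (n - int l)))) (g (n - int k)))
        = (\<Sum>n\<in>I. cinner (C k (D l (g (n + int k)))) (g (n + int l)))"
      by (simp add: algebra_simps)
  qed
  finally have sB: "(\<Sum>n\<in>I. cinner (B n) (B n)) = \<dots>" .
  have "(\<Sum>n\<in>I. cinner (A n) (A n)) + (\<Sum>n\<in>I. cinner (B n) (B n)) =
      (\<Sum>k<M. \<Sum>l<M. a k * cnj (a l) *
        (\<Sum>n\<in>I. cinner (if k = l then g (n + int k) else 0) (g (n + int l))))"
    unfolding sA sB anticommute[symmetric] cinner_add_left
    by (simp add: sum.distrib distrib_left add.commute)
  also have "\<dots> = (\<Sum>k<M. a k * cnj (a k) * (\<Sum>n\<in>I. cinner (g (n + int k)) (g (n + int k))))"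
  proof (rule sum.cong[OF refl])
    fix k
    assume k: "k \<in> {..<M}"
    have "(\<Sum>l<M. a k * cnj (a l) *
        (\<Sum>n\<in>I. cinner (if k = l then g (n + int k) else 0) (g (n + int l)))) =
      (\<Sum>l<M. if l = k then a k * cnj (a k) * (\<Sum>n\<in>I. cinner (g (n + int k)) (g (n + int k))) else 0)"
      by (rule sum.cong) auto
    also have "\<dots> = a k * cnj (a k) * (\<Sum>n\<in>I. cinner (g (n + int k)) (g (n + int k)))"
      using k by simp
    finally show "(\<Sum>l<M. a k * cnj (a l) *
        (\<Sum>n\<in>I. cinner (if k = l then g (n + int k) else 0) (g (n + int l)))) = \<dots>" .
  qed
  finally have "complex_of_real ((\<Sum>n\<in>I. (norm (A n))\<^sup>2) + (\<Sum>n\<in>I. (norm (B n))\<^sup>2)) =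
      complex_of_real (\<Sum>k<M. (cmod (a k))\<^sup>2 * (\<Sum>n\<in>I. (norm (g (n + int k)))\<^sup>2))"
    by (simp add: cinner_self complex_norm_square del: of_real_power)
  then have AB: "(\<Sum>n\<in>I. (norm (A n))\<^sup>2) + (\<Sum>n\<in>I. (norm (B n))\<^sup>2) =
      (\<Sum>k<M. (cmod (a k))\<^sup>2 * (\<Sum>n\<in>I. (norm (g (n + int k)))\<^sup>2))"
    unfolding of_real_eq_iff .
  have g_norm: "(\<Sum>n\<in>I. (norm (g (n + int k)))\<^sup>2) = (\<Sum>j<N. (norm (h j))\<^sup>2)" if "k < M" for k
  proof -
    have "(\<Sum>n\<in>I. (norm (g (n + int k)))\<^sup>2) = (\<Sum>n\<in>I. (norm (g n))\<^sup>2)"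
      unfolding I_def
      by (rule sum_int_shift[where F = "\<lambda>n. (norm (g n))\<^sup>2"])
        (use that g0 in \<open>force simp: W_def M_def\<close>)+
    also have "\<dots> = (\<Sum>n\<in>int ` {..<N}. (norm (g n))\<^sup>2)"
    proof (rule sum.mono_neutral_right)
      show "\<forall>n\<in>I - int ` {..<N}. (norm (g n))\<^sup>2 = 0"
      proof
        fix n assume "n \<in> I - int ` {..<N}"
        then have "\<not> (0 \<le> n \<and> n < int N)"
          by (metis DiffE image_eqI lessThan_iff nat_0_le nat_less_iff)
        then show "(norm (g n))\<^sup>2 = 0" using g0 by auto
      qed
    qed (auto simp: I_def W_def)
    also have "\<dots> = (\<Sum>j<N. (norm (h j))\<^sup>2)"
      by (subst sum.reindex) (auto simp: g_def)
    finally show ?thesis .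
  qed
  have A_row: "A (- int i) = (\<Sum>j<N. a (i + j) *\<^sub>C C (i + j) (h j))" if "i < N" for i
  proof -
    have "A (- int i) = (\<Sum>k\<in>(+) i ` {..<N}. a k *\<^sub>C C k (g (- int i + int k)))"
      unfolding A_def
    proof (rule sum.mono_neutral_right)
      show "\<forall>k\<in>{..<M} - (+) i ` {..<N}. a k *\<^sub>C C k (g (- int i + int k)) = 0"
      proof
        fix k assume k: "k \<in> {..<M} - (+) i ` {..<N}"
        have "\<not> (i \<le> k \<and> k - i < N)"
          using k by (metis DiffE image_eqI le_add_diff_inverse lessThan_iff)
        then have "g (- int i + int k) = 0"
          using g0[of "- int i + int k"] by linarith
        then show "a k *\<^sub>C C k (g (- int i + int k)) = 0" by simp
      qed
    qed (use that in \<open>auto simp: M_def\<close>)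
    also have "\<dots> = (\<Sum>j<N. a (i + j) *\<^sub>C C (i + j) (h j))"
      by (subst sum.reindex) (auto simp: g_def intro!: sum.cong)
    finally show ?thesis .
  qed
  have "(\<Sum>i<N. (norm (\<Sum>j<N. a (i + j) *\<^sub>C C (i + j) (h j)))\<^sup>2) = (\<Sum>i<N. (norm (A (- int i)))\<^sup>2)"
    by (simp add: A_row)
  also have "\<dots> = (\<Sum>n\<in>(\<lambda>i. - int i) ` {..<N}. (norm (A n))\<^sup>2)"
    by (subst sum.reindex) (auto intro: inj_onI)
  also have "\<dots> \<le> (\<Sum>n\<in>I. (norm (A n))\<^sup>2)"
    by (rule sum_mono2) (auto simp: I_def W_def)
  also have "\<dots> \<le> (\<Sum>n\<in>I. (norm (A n))\<^sup>2) + (\<Sum>n\<in>I. (norm (B n))\<^sup>2)"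
    by (simp add: sum_nonneg)
  also have "\<dots> = (\<Sum>k<M. (cmod (a k))\<^sup>2) * (\<Sum>j<N. (norm (h j))\<^sup>2)"
    unfolding AB sum_distrib_right by (rule sum.cong) (simp_all add: g_norm)
  finally show ?thesis unfolding M_def .
qed

definition hankel :: "(nat \<Rightarrow> complex) \<Rightarrow> 'h ell2 \<Rightarrow> 'h ell2"
  where "hankel a = matrix_operator (\<lambda>i j x. a (i + j) *\<^sub>C C (i + j) x)"

context
  fixes a :: "nat \<Rightarrow> complex"
  assumes a: "summable (\<lambda>k. (cmod (a k))\<^sup>2)"
begin

lemma summable_hankel_row: "summable (\<lambda>j. a (i + j) *\<^sub>C C (i + j) (ell2_nth h j))"
proof (rule summable_comparison_test)
  have "summable (\<lambda>j. (norm (a (i + j)))\<^sup>2)"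
    using a by (subst add.commute) (rule summable_ignore_initial_segment)
  then show "summable (\<lambda>j. norm (a (i + j)) * norm (ell2_nth h j))"
    using summable_inner[of "\<lambda>j. norm (a (i + j))" "\<lambda>j. norm (ell2_nth h j)"] summable_ell2[of h]
    by simp
  show "\<exists>N. \<forall>j\<ge>N. norm (a (i + j) *\<^sub>C C (i + j) (ell2_nth h j))
      \<le> norm (a (i + j)) * norm (ell2_nth h j)"
    by (auto simp: norm_scaleC intro!: mult_left_mono norm_C_le)
qed

text \<open>Letting the truncation of the columns tend to infinity for a fixed number of rows.\<close>

lemma sum_hankel_rows_le:
  "(\<Sum>i<N. (norm (\<Sum>j. a (i + j) *\<^sub>C C (i + j) (ell2_nth h j)))\<^sup>2)
    \<le> (\<Sum>k. (cmod (a k))\<^sup>2) * (norm h)\<^sup>2"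
proof (rule LIMSEQ_le_const2)
  show "(\<lambda>P. \<Sum>i<N. (norm (\<Sum>j<P. a (i + j) *\<^sub>C C (i + j) (ell2_nth h j)))\<^sup>2)
      \<longlonglongrightarrow> (\<Sum>i<N. (norm (\<Sum>j. a (i + j) *\<^sub>C C (i + j) (ell2_nth h j)))\<^sup>2)"
    by (intro tendsto_intros summable_LIMSEQ summable_hankel_row)
  have "(\<Sum>i<N. (norm (\<Sum>j<P. a (i + j) *\<^sub>C C (i + j) (ell2_nth h j)))\<^sup>2)
      \<le> (\<Sum>k. (cmod (a k))\<^sup>2) * (norm h)\<^sup>2" if "P \<ge> N" for P
  proof -
    have "(\<Sum>i<N. (norm (\<Sum>j<P. a (i + j) *\<^sub>C C (i + j) (ell2_nth h j)))\<^sup>2)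
        \<le> (\<Sum>i<P. (norm (\<Sum>j<P. a (i + j) *\<^sub>C C (i + j) (ell2_nth h j)))\<^sup>2)"
      using that by (intro sum_mono2) auto
    also have "\<dots> \<le> (\<Sum>k<2*P. (cmod (a k))\<^sup>2) * (\<Sum>j<P. (norm (ell2_nth h j))\<^sup>2)"
      by (rule norm_hankel_finite)
    also have "\<dots> \<le> (\<Sum>k. (cmod (a k))\<^sup>2) * (norm h)\<^sup>2"
      by (intro mult_mono sum_le_suminf a sum_norm_ell2_le suminf_nonneg sum_nonneg) auto
    finally show ?thesis .
  qed
  then show "\<exists>P0. \<forall>P\<ge>P0. (\<Sum>i<N. (norm (\<Sum>j<P. a (i + j) *\<^sub>C C (i + j) (ell2_nth h j)))\<^sup>2)
      \<le> (\<Sum>k. (cmod (a k))\<^sup>2) * (norm h)\<^sup>2"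
    by blast
qed

lemma ell2_nth_hankel:
  "ell2_nth (hankel a h) i = (\<Sum>j. a (i + j) *\<^sub>C C (i + j) (ell2_nth h j))"
proof -
  have "summable (\<lambda>i. (norm (\<Sum>j. a (i + j) *\<^sub>C C (i + j) (ell2_nth h j)))\<^sup>2)"
    by (rule summableI_nonneg_bounded[where x = "(\<Sum>k. (cmod (a k))\<^sup>2) * (norm h)\<^sup>2"])
      (simp_all add: sum_hankel_rows_le)
  then show ?thesis
    by (simp add: hankel_def matrix_operator_def Abs_ell2_inverse)
qed

lemma norm_hankel_le: "norm (hankel a h) \<le> sqrt (\<Sum>k. (cmod (a k))\<^sup>2) * norm h"
proof -
  have "(norm (hankel a h))\<^sup>2 \<le> (\<Sum>k. (cmod (a k))\<^sup>2) * (norm h)\<^sup>2"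
    unfolding norm_ell2_sq[of "hankel a h"]
    by (rule suminf_le_const[OF summable_ell2]) (simp add: ell2_nth_hankel sum_hankel_rows_le)
  then have "sqrt ((norm (hankel a h))\<^sup>2) \<le> sqrt ((\<Sum>k. (cmod (a k))\<^sup>2) * (norm h)\<^sup>2)"
    by (rule real_sqrt_le_mono)
  then show ?thesis
    by (simp add: real_sqrt_mult)
qed

lemma bounded_clinear_hankel: "bounded_clinear (hankel a)"
proof (rule bounded_clinearI)
  have C: "C k (x + y) = C k x + C k y" "C k (c *\<^sub>C x) = c *\<^sub>C C k x" for k x y c
    using linear[of k] clinear[of k]
    by (auto simp: bounded_clinear_def linear_add bounded_linear.linear)
  show "hankel a (g + h) = hankel a g + hankel a h" for g h
    by (rule ell2_eqI) (simp add: ell2_nth_hankel plus_ell2.rep_eq C scaleC_add_right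
        suminf_add summable_hankel_row)
  show "hankel a (c *\<^sub>C h) = c *\<^sub>C hankel a h" for c h
  proof (rule ell2_eqI)
    fix i
    show "ell2_nth (hankel a (c *\<^sub>C h)) i = ell2_nth (c *\<^sub>C hankel a h) i"
      using bounded_linear.suminf[OF bounded_linear_scaleC_right summable_hankel_row[of i h], of c]
      by (simp add: ell2_nth_hankel scaleC_ell2.rep_eq C scaleC_scaleC mult.commute)
  qed
  show "norm (hankel a h) \<le> sqrt (\<Sum>k. (cmod (a k))\<^sup>2) * norm h" for h
    by (rule norm_hankel_le)
qed

end

end

section \<open>Block triangular operators similar to contractions\<close>

text \<open>The unipotent matrix with corner \<open>-X\<close> conjugates the operator to \<open>A \<oplus> D\<close>.\<close>

lemma similar_to_contraction_block_operator:
  fixes A :: "'a::complex_hilbert \<Rightarrow> 'a" and D :: "'b::complex_hilbert \<Rightarrow> 'b"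
  assumes A: "bounded_clinear A" "\<And>x. norm (A x) \<le> norm x"
    and D: "bounded_clinear D" "\<And>x. norm (D x) \<le> norm x"
    and Y: "bounded_clinear Y" and X: "bounded_clinear X"
    and sylvester: "\<And>x. Y x = A (X x) - X (D x)"
  shows "similar_to_contraction (block_operator A Y (\<lambda>_. 0) D)"
  unfolding similar_to_contraction_def
proof (intro conjI exI)
  let ?T = "block_operator A Y (\<lambda>_. 0) D"
  let ?L = "block_operator (\<lambda>x. x) (\<lambda>x. - X x) (\<lambda>_. 0) (\<lambda>x. x)"
  let ?L' = "block_operator (\<lambda>x. x) X (\<lambda>_. 0) (\<lambda>x. x)"
  show "bounded_clinear ?T" "bounded_clinear ?L" "bounded_clinear ?L'"
    by (intro bounded_clinear_block_operator bounded_clinear_id bounded_clinear_zero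
        bounded_clinear_uminus A D Y X)+
  show "?L \<circ> ?L' = id" "?L' \<circ> ?L = id"
    by (auto simp: block_operator_def)
  have "A (x - y) = A x - A y" for x y
    using A(1) by (simp add: bounded_clinear_def linear_diff bounded_linear.linear)
  then have "(?L' \<circ> ?T \<circ> ?L) (x, y) = (A x, D y)" for x y
    by (simp add: block_operator_def sylvester)
  moreover have "norm (A x, D y) \<le> norm (x, y)" for x y
    unfolding norm_Pair by (intro real_sqrt_le_mono add_mono power_mono A D norm_ge_zero)
  ultimately show "onorm (?L' \<circ> ?T \<circ> ?L) \<le> 1"
    by (intro onorm_bound) auto
qed

text \<open>For \<open>X = (\<Sum>m. S\<^sup>m\<^sup>+\<^sup>1 T\<^sup>m Y)\<close> the relations \<open>T S = I\<close> and \<open>Y S = T Y\<close> give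
  \<open>T X = (\<Sum>m. S\<^sup>m T\<^sup>m Y)\<close> and \<open>X S = (\<Sum>m. S\<^sup>m\<^sup>+\<^sup>1 T\<^sup>m\<^sup>+\<^sup>1 Y)\<close>, which differ by the term \<open>Y\<close>
  at \<open>m = 0\<close>.\<close>

lemma sylvester_solution:
  fixes S T Y :: "'a::complex_hilbert \<Rightarrow> 'a"
  assumes S: "bounded_clinear S" "\<And>x. norm (S x) \<le> norm x"
    and T: "bounded_clinear T" and TS: "\<And>x. T (S x) = x"
    and Y: "bounded_clinear Y" and YS: "\<And>x. Y (S x) = T (Y x)"
    and c: "summable c" "\<And>m x. norm ((T ^^ m) (Y x)) \<le> c m * norm x"
  obtains X where "bounded_clinear X" "\<And>x. Y x = T (X x) - X (S x)"
proof
  let ?t = "\<lambda>m x. (S ^^ Suc m) ((T ^^ m) (Y x))"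
  define X where "X x = (\<Sum>m. ?t m x)" for x
  have norm_pow: "norm ((S ^^ n) x) \<le> norm x" for n x
    by (induction n) (auto intro: order_trans[OF S(2)])
  have norm_t: "norm (?t m x) \<le> c m * norm x" for m x
    using norm_pow c(2) order_trans by blast
  have sum_norm: "summable (\<lambda>m. norm (?t m x))" for x
    by (rule summable_comparison_test[OF _ summable_mult2[OF c(1), of "norm x"]])
      (use norm_t in simp)
  have sum: "summable (\<lambda>m. ?t m x)" for x
    using sum_norm by (rule summable_norm_cancel)
  have lin: "bounded_linear S" "bounded_linear T" "bounded_linear Y"
    using S T Y by (auto simp: bounded_clinear_def)
  have pow_add: "(S ^^ n) (x + y) = (S ^^ n) x + (S ^^ n) y" "(T ^^ n) (x + y) = (T ^^ n) x + (T ^^ n) y"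
    and pow_scale: "(S ^^ n) (r *\<^sub>C x) = r *\<^sub>C (S ^^ n) x" "(T ^^ n) (r *\<^sub>C x) = r *\<^sub>C (T ^^ n) x" for n x y r
    using lin S(1) T
    by (induction n) (auto simp: bounded_clinear_def linear_add bounded_linear.linear)
  have Y': "Y (x + y) = Y x + Y y" "Y (r *\<^sub>C x) = r *\<^sub>C Y x" for x y r
    using lin(3) Y by (auto simp: bounded_clinear_def linear_add bounded_linear.linear)
  show "bounded_clinear X"
  proof (rule bounded_clinearI)
    show "X (x + y) = X x + X y" for x y
      unfolding X_def pow_add Y' by (rule suminf_add[symmetric]) (rule sum)+
    show "X (r *\<^sub>C x) = r *\<^sub>C X x" for r x
      unfolding X_def pow_scale Y'
      by (rule bounded_linear.suminf[OF bounded_linear_scaleC_right sum, symmetric])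
    show "norm (X x) \<le> (\<Sum>m. c m) * norm x" for x
    proof -
      have "norm (X x) \<le> (\<Sum>m. norm (?t m x))"
        unfolding X_def by (rule summable_norm[OF sum_norm])
      also have "\<dots> \<le> (\<Sum>m. c m * norm x)"
        by (intro suminf_le norm_t sum_norm summable_mult2 c)
      also have "\<dots> = (\<Sum>m. c m) * norm x"
        by (rule suminf_mult2[OF c(1), symmetric])
      finally show ?thesis .
    qed
  qed
  show "Y x = T (X x) - X (S x)" for x
  proof -
    let ?u = "\<lambda>m. (S ^^ m) ((T ^^ m) (Y x))"
    have T_t: "T (?t m x) = ?u m" for m
      by (simp add: TS)
    have "T (X x) = (\<Sum>m. ?u m)" and "summable ?u"
      using bounded_linear.suminf[OF lin(2) sum[of x]] bounded_linear.summable[OF lin(2) sum[of x]]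
      by (simp_all only: T_t X_def)
    moreover have "X (S x) = (\<Sum>m. ?u (Suc m))"
      by (simp only: X_def YS funpow_Suc_right o_apply)
    ultimately show ?thesis
      using suminf_split_head[of ?u] by simp
  qed
qed

section \<open>The shift and its adjoint\<close>

lift_definition unshift :: "'a::real_inner ell2 \<Rightarrow> 'a ell2" is "\<lambda>h n. h (Suc n)"
  by (subst summable_Suc_iff)

lemma ell2_nth_shift: "ell2_nth (shift h) n = (case n of 0 \<Rightarrow> 0 | Suc m \<Rightarrow> ell2_nth h m)"
  by (simp add: shift.rep_eq)

lemma unshift_shift: "unshift (shift h) = h"
  by (rule ell2_eqI) (simp add: unshift.rep_eq ell2_nth_shift)

lemma ell2_nth_unshift_funpow: "ell2_nth ((unshift ^^ m) h) n = ell2_nth h (m + n)"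
  by (induction m arbitrary: n) (simp_all add: unshift.rep_eq)

lemma norm_shift: "norm (shift h) = norm h"
proof -
  have "(norm (shift h))\<^sup>2 = (norm h)\<^sup>2"
    using suminf_split_head[OF summable_ell2[of "shift h"]]
    by (simp add: norm_ell2_sq ell2_nth_shift)
  then show ?thesis by simp
qed

lemma norm_unshift_le: "norm (unshift h) \<le> norm h"
proof -
  have "(norm (unshift h))\<^sup>2 \<le> (norm h)\<^sup>2"
    using suminf_split_head[OF summable_ell2[of h]]
    by (simp add: norm_ell2_sq unshift.rep_eq)
  then show ?thesis by (simp add: power2_le_iff_abs_le)
qed

lemma bounded_clinear_shift: "bounded_clinear (shift :: 'a::complex_inner ell2 \<Rightarrow> 'a ell2)"
  by (rule bounded_clinearI[where K = 1])
    (auto intro!: ell2_eqI simp: ell2_nth_shift plus_ell2.rep_eq scaleC_ell2.rep_eq norm_shift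
      split: nat.split)

lemma bounded_clinear_unshift: "bounded_clinear (unshift :: 'a::complex_inner ell2 \<Rightarrow> 'a ell2)"
  by (rule bounded_clinearI[where K = 1])
    (auto intro!: ell2_eqI simp: unshift.rep_eq plus_ell2.rep_eq scaleC_ell2.rep_eq norm_unshift_le)

lemma cadjoint_shift: "cadjoint shift = (unshift :: 'a::complex_hilbert ell2 \<Rightarrow> 'a ell2)"
proof (rule cadjoint_eqI)
  fix g h :: "'a ell2"
  show "cinner (shift g) h = cinner g (unshift h)"
    using suminf_split_head[OF summable_cinner_ell2[of "shift g" h]]
    by (simp add: cinner_ell2.rep_eq unshift.rep_eq ell2_nth_shift)
qed

section \<open>Foguel-Hankel operators over the anticommutation relations\<close>

context car_sequence
begin

lemma hankel_shift:
  assumes a: "summable (\<lambda>k. (cmod (a k))\<^sup>2)"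
  shows "hankel a (shift h) = unshift (hankel a h)"
proof (rule ell2_eqI)
  fix i
  show "ell2_nth (hankel a (shift h)) i = ell2_nth (unshift (hankel a h)) i"
    using suminf_split_head[OF summable_hankel_row[OF a, of i "shift h"]]
    by (simp add: unshift.rep_eq ell2_nth_hankel[OF a] ell2_nth_shift)
qed

text \<open>Setting the coefficients below \<open>m\<close> to zero does not change the rows from \<open>m\<close> on, so the norm is
  bounded by the \<open>\<ell>\<^sup>2\<close> tail of \<open>a\<close>; on that tail the weight is at least \<open>(m + 1)\<close> to the power \<open>p\<close>.\<close>

lemma norm_unshift_hankel_le:
  assumes a: "summable (\<lambda>k. (cmod (a k))\<^sup>2)"
    and w: "summable (\<lambda>k. real (k + 1) powr p * (cmod (a k))\<^sup>2)" and p: "p \<ge> 0"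
  shows "norm ((unshift ^^ m) (hankel a h)) \<le>
    sqrt (\<Sum>k. real (k + 1) powr p * (cmod (a k))\<^sup>2) * real (m + 1) powr (- p / 2) * norm h"
proof -
  define b where "b k = (if k < m then 0 else a k)" for k
  have b_le: "(cmod (b k))\<^sup>2 \<le> (cmod (a k))\<^sup>2" for k
    by (simp add: b_def)
  have b: "summable (\<lambda>k. (cmod (b k))\<^sup>2)"
    by (rule summable_comparison_test[OF _ a]) (simp add: b_le)
  have "(unshift ^^ m) (hankel a h) = (unshift ^^ m) (hankel b h)"
    by (rule ell2_eqI) (simp add: ell2_nth_unshift_funpow ell2_nth_hankel[OF a] ell2_nth_hankel[OF b] b_def)
  moreover have "norm ((unshift ^^ m) g) \<le> norm g" for g :: "'h ell2"
    by (induction m) (auto intro: order_trans[OF norm_unshift_le])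
  ultimately have "norm ((unshift ^^ m) (hankel a h)) \<le> norm (hankel b h)"
    by simp
  also have "\<dots> \<le> sqrt (\<Sum>k. (cmod (b k))\<^sup>2) * norm h"
    by (rule norm_hankel_le[OF b])
  also have "(\<Sum>k. (cmod (b k))\<^sup>2) \<le> (\<Sum>k. real (m + 1) powr (- p) * (real (k + 1) powr p * (cmod (a k))\<^sup>2))"
  proof (intro suminf_le b summable_mult w)
    fix k
    show "(cmod (b k))\<^sup>2 \<le> real (m + 1) powr (- p) * (real (k + 1) powr p * (cmod (a k))\<^sup>2)"
    proof (cases "k < m")
      case False
      then have "real (m + 1) powr p \<le> real (k + 1) powr p"
        using p by (intro powr_mono2) auto
      then have "1 \<le> real (m + 1) powr (- p) * real (k + 1) powr p"
        by (simp add: powr_minus divide_simps)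
      then have "1 * (cmod (a k))\<^sup>2 \<le> (real (m + 1) powr (- p) * real (k + 1) powr p) * (cmod (a k))\<^sup>2"
        by (rule mult_right_mono) simp
      then show ?thesis
        using False by (simp add: b_def mult.assoc)
    qed (simp add: b_def)
  qed
  also have "(\<Sum>k. real (m + 1) powr (- p) * (real (k + 1) powr p * (cmod (a k))\<^sup>2))
      = real (m + 1) powr (- p) * (\<Sum>k. real (k + 1) powr p * (cmod (a k))\<^sup>2)"
    by (rule suminf_mult[OF w])
  also have "sqrt \<dots> = sqrt (\<Sum>k. real (k + 1) powr p * (cmod (a k))\<^sup>2) * real (m + 1) powr (- p / 2)"
    using powr_half_sqrt_powr[of "real (m + 1)" "- p"] by (simp add: real_sqrt_mult)
  finally show ?thesis
    by (simp add: mult_right_mono)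
qed

text \<open>The threshold \<open>p > 2\<close> is where the decay exponent \<open>p / 2\<close> becomes summable.\<close>

lemma similar_to_contraction_foguel_hankel:
  assumes a: "summable (\<lambda>k. (cmod (a k))\<^sup>2)"
    and w: "summable (\<lambda>k. real (k + 1) powr p * (cmod (a k))\<^sup>2)" and p: "p > 2"
  shows "similar_to_contraction (foguel_hankel (hankel a))"
proof -
  let ?K = "sqrt (\<Sum>k. real (k + 1) powr p * (cmod (a k))\<^sup>2)"
  have "summable (\<lambda>m. real (Suc m) powr (- p / 2))"
    unfolding summable_Suc_iff[where f = "\<lambda>m. real m powr (- p / 2)"] using p
    by (simp add: summable_real_powr_iff)
  then have c: "summable (\<lambda>m. ?K * real (m + 1) powr (- p / 2))"
    by (intro summable_mult) simp
  obtain X where "bounded_clinear X" "\<And>h. hankel a h = unshift (X h) - X (shift h)"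
    by (rule sylvester_solution[OF bounded_clinear_shift _ bounded_clinear_unshift unshift_shift
          bounded_clinear_hankel[OF a] hankel_shift[OF a] c])
      (use norm_unshift_hankel_le[OF a w] p in \<open>simp_all add: norm_shift\<close>)
  then show ?thesis
    unfolding foguel_hankel_def cadjoint_shift
    by (intro similar_to_contraction_block_operator bounded_clinear_shift bounded_clinear_unshift
        bounded_clinear_hankel a norm_unshift_le) (simp_all add: norm_shift)
qed

end

theorem corollary2p5:
  fixes \<Lambda> :: "'h::complex_hilbert \<Rightarrow> 'h \<Rightarrow> 'h"
    and e :: "nat \<Rightarrow> 'h"
    and \<alpha> :: "nat \<Rightarrow> complex"
    and \<epsilon> :: real
  assumes "canonical_anticommutation \<Lambda>"
    and "orthonormal_basis e"
    and "\<epsilon> > 0"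
    and "summable (\<lambda>k. (cmod (\<alpha> k))\<^sup>2)"
    and "summable (\<lambda>k. real (k + 1) powr (2 + \<epsilon>) * (cmod (\<alpha> k))\<^sup>2)"
  shows "similar_to_contraction (foguel_hankel (car_hankel \<Lambda> e \<alpha>))"
proof -
  interpret car_sequence "\<lambda>k. \<Lambda> (e k)" "\<lambda>k. cadjoint (\<Lambda> (e k))"
  proof
    fix k l x y
    show "bounded_clinear (\<Lambda> (e k))"
      using assms(1) by (simp add: canonical_anticommutation_def)
    then show "cinner (\<Lambda> (e k) x) y = cinner x (cadjoint (\<Lambda> (e k)) y)"
      by (rule cinner_cadjoint)
    have "cinner (e k) (e l) *\<^sub>C x = (if k = l then x else 0)"
      using assms(2) scaleC_of_real[of 1 x] scaleC_of_real[of 0 x]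
      by (simp add: orthonormal_basis_def)
    then show "\<Lambda> (e k) (cadjoint (\<Lambda> (e l)) x) + cadjoint (\<Lambda> (e l)) (\<Lambda> (e k) x)
        = (if k = l then x else 0)"
      using assms(1) by (simp add: canonical_anticommutation_def)
  qed
  have "car_hankel \<Lambda> e \<alpha> = hankel \<alpha>"
    by (simp add: car_hankel_def hankel_def)
  then show ?thesis
    using similar_to_contraction_foguel_hankel[OF assms(4,5)] assms(3) by simp
qed

end
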